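(* Let $\bm{p}=(p_j)_{j\ge 1}$ be a probability distribution with $p_j>0$ for all $j\ge1$ and $\sum_{j\ge1}p_j=1$, and for $x\in(0,1]$ let $\vec{\nu}(x)=\#\{j\ge1: p_j\ge x\}$. Assume that there exist $\alpha\in(0,1)$ and a function $L$ slowly varying at infinity such that $$\vec{\nu}(x)=x^{-\alpha}L(x^{-1}),\qquad x\in(0,1].$$ Let $H(\bm{p})$ be the Shannon entropy of $\bm p$ and, for $t>0$, let $\hat H(t)$ be the Poissonized plug-in entropy estimator. Then, as $t\to\infty$, $$H(\bm{p})-\mathsf{E}[\hat H(t)]\ \sim\ t^{\alpha-1}L(t)\,C_\alpha,$$ where $$C_\alpha=\int_0^\infty y^{-\alpha}\psi(y)\,\mathrm{d}y,\qquad \psi(y)=-\log y-1+\mathsf{E}\left[(P_y+1-y)\log(P_y+1)\right]\quad(y>0),$$ and $P_y$ denotes a Poisson random variable with mean $y$.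
   Context: The Shannon entropy is $H(\bm{p})=-\sum_{j\ge1}p_j\log p_j$ (natural logarithm); it is finite under the stated assumption on $\vec\nu$. For $t>0$, let $(X_j(t))_{j\ge1}$ be independent random variables with $X_j(t)$ Poisson distributed with mean $tp_j$ (these are the category counts of a sample of random size $N(t)\sim\mathrm{Pois}(t)$ drawn from $\bm p$). The Poissonized plug-in estimator is $$\hat H(t)=-\sum_{j\ge1}\frac{X_j(t)}{t}\log\left(\frac{X_j(t)}{t}\right),$$ with the convention $0\log 0=0$. The quantity $H(\bm p)-\mathsf{E}[\hat H(t)]$ is called the Poissonized absolute bias. A function $L$ is slowly varying (at infinity) if $\lim_{x\to\infty}L(\lambda x)/L(x)=1$ for every $\lambda>0$; here $L$ is defined on $[1,\infty)$ and positive for all sufficiently large arguments (the displayed identity forces $L(u)=0$ for $1\le u<1/\max_j p_j$). The notation $f(t)\sim g(t)$ means $f(t)/g(t)\to1$. *)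

theory Defs
  imports "HOL-Probability.Probability" "HOL-Library.Landau_Symbols"
begin

unbundle asymp_equiv_syntax

text \<open>
  Distributions and samples on the countable set of categories are sequences indexed by
  \<^typ>\<open>nat\<close>, i.e. the index is shifted by one from \<open>j \<ge> 1\<close> to \<open>j \<ge> 0\<close>.
\<close>

definition counting_fun :: "(nat \<Rightarrow> real) \<Rightarrow> real \<Rightarrow> nat" where
  "counting_fun p x = card {j. p j \<ge> x}"

definition slowly_varying :: "(real \<Rightarrow> real) \<Rightarrow> bool" where
  "slowly_varying L \<longleftrightarrow> (\<forall>c>0. ((\<lambda>x. L (c * x) / L x) \<longlongrightarrow> 1) at_top)"

definition shannon_entropy :: "(nat \<Rightarrow> real) \<Rightarrow> real" where
  "shannon_entropy p = - (\<Sum>j. p j * ln (p j))"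

text \<open>
  The argument \<open>c\<close> is a realisation of the sequence of category counts. The normalisation is by the
  intensity \<open>t\<close>, not by the random sample size. The convention \<open>0 log 0 = 0\<close> holds automatically, so
  for finitely supported \<open>c\<close> (almost every realisation of the Poisson counts) the series is a
  finite sum.
\<close>
definition poissonized_plug_in :: "real \<Rightarrow> (nat \<Rightarrow> nat) \<Rightarrow> real" where
  "poissonized_plug_in t c = - (\<Sum>j. real (c j) / t * ln (real (c j) / t))"

definition psi :: "real \<Rightarrow> real" where
  "psi y = - ln y - 1 +
     measure_pmf.expectation (poisson_pmf y) (\<lambda>k. (real k + 1 - y) * ln (real k + 1))"

definition C_const :: "real \<Rightarrow> real" where
  "C_const \<alpha> = (LBINT y:{0<..}. y powr (-\<alpha>) * psi y)"

end

theory Submission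
  imports Defs "HOL-Real_Asymp.Real_Asymp"
begin

text \<open>
  Write \<open>P\<^sub>y\<close> for a Poisson variable of mean \<open>y\<close> and \<open>H\<^sub>t\<close> for the plug-in estimator. Linearity
  of expectation makes the bias a sum over the categories, and the Stein--Chen identity \<open>E[P\<^sub>y ln P\<^sub>y] = y E[ln (P\<^sub>y + 1)]\<close> evaluates its terms:
  \<open>H(p) - E[H\<^sub>t] = \<Sum>\<^sub>j p\<^sub>j \<phi>(t p\<^sub>j) = (1 / t) \<Sum>\<^sub>j g(t p\<^sub>j)\<close>,
  where \<open>\<phi>(y) = E[ln (P\<^sub>y + 1)] - ln y\<close> (\<open>log_excess\<close>) and \<open>g(y) = y \<phi>(y)\<close>. The function \<open>g\<close> vanishes at \<open>0\<close>
  and its derivative is \<open>psi\<close> (\<open>DERIV_bias_psi\<close>), so writing \<open>g\<close> as an integral of \<open>psi\<close> and counting how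
  many \<open>t p\<^sub>j\<close> are at least \<open>y\<close> gives (\<open>sums_level_integral\<close>)
  \<open>t (H(p) - E[H\<^sub>t]) = \<integral> N(t / y) psi(y) dy\<close> over \<open>y > 0\<close>,
  where \<open>N(u)\<close> is the number of categories with probability at least \<open>1 / u\<close> (\<open>category_count\<close>), that is,
  \<open>u\<^sup>\<alpha> L(u)\<close> for \<open>u \<ge> 1\<close>.

  Regular variation gives \<open>N(t / y) / N(t) \<longlongrightarrow> y\<^sup>-\<^sup>\<alpha>\<close> for each \<open>y\<close>, and it remains to dominate. The kernel is
  handled by Potter's bounds (\<open>potter_bounds\<close>), which are elementary here because \<open>N\<close> is monotone. For \<open>psi\<close>
  the tangent-line forms of Jensen's inequality give \<open>\<bar>psi y\<bar> \<le> 2 / y\<close> for all \<open>y\<close> and a logarithmic bound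
  near \<open>0\<close>. Dominated convergence (\<open>regularly_varying_integral_limit\<close>) then shows that
  \<open>t (H(p) - E[H\<^sub>t]) / N(t)\<close> tends to \<open>C\<^sub>\<alpha>\<close>.

  This is an asymptotic equivalence only if \<open>C\<^sub>\<alpha> \<noteq> 0\<close>. Since \<open>\<phi>(y) \<ge> e\<^sup>-\<^sup>y\<close>, the categories with
  \<open>1 \<le> t p\<^sub>j < 2\<close> alone contribute at least \<open>e\<^sup>-\<^sup>2 (N(t) - N(t / 2))\<close> to \<open>\<Sum>\<^sub>j g(t p\<^sub>j)\<close>, hence
  \<open>C\<^sub>\<alpha> \<ge> e\<^sup>-\<^sup>2 (1 - 2\<^sup>-\<^sup>\<alpha>) > 0\<close> (\<open>bias_lower\<close>).
\<close>

section \<open>Poisson means\<close>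

abbreviation poisson_mean :: "(nat \<Rightarrow> real) \<Rightarrow> real \<Rightarrow> real" where
  "poisson_mean f y \<equiv> measure_pmf.expectation (poisson_pmf y) f"

text \<open>
  The growth condition \<open>f \<in> O(2\<^sup>k)\<close> holds for every function of the Poisson count considered here,
  and it makes the exponential generating function of \<open>f\<close> entire.
\<close>

lemma summable_exp_series:
  fixes f :: "nat \<Rightarrow> real"
  assumes f: "f \<in> O(\<lambda>k. 2 ^ k)"
  shows "summable (\<lambda>k. f k / fact k * y ^ k)"
proof -
  have "summable (\<lambda>k. norm ((2 * y) ^ k / fact k))"
    using summable_norm_exp[of "2 * y"] by (simp add: field_simps)
  moreover have "(\<lambda>k. f k * (y ^ k / fact k)) \<in> O(\<lambda>k. 2 ^ k * (y ^ k / fact k))"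
    by (intro landau_o.big.mult f) simp
  then have "(\<lambda>k. f k / fact k * y ^ k) \<in> O(\<lambda>k. (2 * y) ^ k / fact k)"
    by (simp add: field_simps power_mult_distrib)
  ultimately show ?thesis
    by (rule summable_comparison_test_bigo)
qed

lemma
  fixes f :: "nat \<Rightarrow> real"
  assumes y: "0 < y" and f: "f \<in> O(\<lambda>k. 2 ^ k)"
  shows integrable_poisson: "integrable (measure_pmf (poisson_pmf y)) f"
    and poisson_mean_eq_suminf: "poisson_mean f y = exp (- y) * (\<Sum>k. f k / fact k * y ^ k)"
proof -
  have eq: "pmf (poisson_pmf y) k * f k = exp (- y) * (f k / fact k * y ^ k)" for k
    using y by simp
  have "summable (\<lambda>k. \<bar>f k\<bar> / fact k * y ^ k)"
    by (rule summable_exp_series) (use f in simp)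
  then have "summable (\<lambda>k. norm (pmf (poisson_pmf y) k * f k))"
    unfolding eq using y by (simp add: abs_mult summable_mult del: times_divide_eq_right)
  then have int: "integrable (count_space UNIV) (\<lambda>k. pmf (poisson_pmf y) k * f k)"
    by (simp add: integrable_count_space_nat_iff)
  show "integrable (measure_pmf (poisson_pmf y)) f"
    unfolding measure_pmf_eq_density using int
    by (subst integrable_real_density) auto
  have "poisson_mean f y = (\<integral>k. pmf (poisson_pmf y) k * f k \<partial>count_space UNIV)"
    unfolding measure_pmf_eq_density by (subst integral_real_density) auto
  also have "\<dots> = (\<Sum>k. pmf (poisson_pmf y) k * f k)"
    using sums_integral_count_space_nat[OF int] by (simp add: sums_iff)
  also have "\<dots> = exp (- y) * (\<Sum>k. f k / fact k * y ^ k)"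
    unfolding eq by (rule suminf_mult) (rule summable_exp_series[OF f])
  finally show "poisson_mean f y = exp (- y) * (\<Sum>k. f k / fact k * y ^ k)" .
qed

lemma bigo_power2_shift:
  fixes f :: "nat \<Rightarrow> real"
  assumes "f \<in> O(\<lambda>k. 2 ^ k)"
  shows "(\<lambda>k. f (Suc k)) \<in> O(\<lambda>k. 2 ^ k)"
  using landau_o.big.compose[OF assms filterlim_Suc] by simp

text \<open>
  The Stein--Chen identity \<open>E[P f(P)] = y E[f(P + 1)]\<close> for a Poisson variable \<open>P\<close> of mean \<open>y\<close>. It turns
  \<open>P ln P\<close> into \<open>ln (P + 1)\<close>, and so the entropy of a count into an average logarithm.
\<close>

lemma poisson_mean_size_bias:
  fixes f :: "nat \<Rightarrow> real"
  assumes y: "0 < y" and f: "(\<lambda>k. real k * f k) \<in> O(\<lambda>k. 2 ^ k)"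
    and f': "(\<lambda>k. f (Suc k)) \<in> O(\<lambda>k. 2 ^ k)"
  shows "poisson_mean (\<lambda>k. real k * f k) y = y * poisson_mean (\<lambda>k. f (Suc k)) y"
proof -
  have "(\<Sum>k. real k * f k / fact k * y ^ k) = (\<Sum>k. real (Suc k) * f (Suc k) / fact (Suc k) * y ^ Suc k)"
    using suminf_split_head[OF summable_exp_series[OF f, of y]] by simp
  also have "\<dots> = (\<Sum>k. y * (f (Suc k) / fact k * y ^ k))"
    by (intro suminf_cong) (simp add: fact_Suc field_simps del: of_nat_Suc)
  also have "\<dots> = y * (\<Sum>k. f (Suc k) / fact k * y ^ k)"
    by (rule suminf_mult) (rule summable_exp_series[OF f'])
  finally show ?thesis
    by (simp add: poisson_mean_eq_suminf[OF y f] poisson_mean_eq_suminf[OF y f'])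
qed

text \<open>
  Differentiating a Poisson mean in its parameter replaces the function by its forward difference:
  the derivative of the generating function is its index shift, and the factor \<open>e\<^sup>-\<^sup>y\<close> contributes the
  subtracted term.
\<close>

lemma DERIV_poisson_mean:
  fixes f :: "nat \<Rightarrow> real"
  assumes y: "0 < y" and f: "f \<in> O(\<lambda>k. 2 ^ k)"
  shows "((\<lambda>y. poisson_mean f y) has_real_derivative
          poisson_mean (\<lambda>k. f (Suc k)) y - poisson_mean f y) (at y)"
proof -
  let ?F = "\<lambda>f y. \<Sum>k. f k / fact k * y ^ k :: real"
  have "(?F f has_real_derivative (\<Sum>k. diffs (\<lambda>k. f k / fact k) k * y ^ k)) (at y)"
    by (rule termdiffs_strong_converges_everywhere) (rule summable_exp_series[OF f])
  also have "(\<lambda>k. diffs (\<lambda>k. f k / fact k) k * y ^ k) = (\<lambda>k. f (Suc k) / fact k * y ^ k)"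
    by (rule ext) (simp add: diffs_def fact_Suc field_simps del: of_nat_Suc)
  finally have "((\<lambda>y. exp (- y) * ?F f y) has_real_derivative
      exp (- y) * ?F (\<lambda>k. f (Suc k)) y - exp (- y) * ?F f y) (at y)"
    by (auto intro!: derivative_eq_intros)
  also have "exp (- y) * ?F (\<lambda>k. f (Suc k)) y = poisson_mean (\<lambda>k. f (Suc k)) y"
    by (rule poisson_mean_eq_suminf[symmetric, OF y bigo_power2_shift[OF f]])
  also have "exp (- y) * ?F f y = poisson_mean f y"
    by (rule poisson_mean_eq_suminf[symmetric, OF y f])
  finally show ?thesis
    by (rule DERIV_cong_ev[THEN iffD1, rotated -1])
       (use y in \<open>auto simp: poisson_mean_eq_suminf[OF _ f] eventually_nhds intro!: exI[of _ "{0<..}"]\<close>)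
qed

section \<open>The bias contributed by one category\<close>

text \<open>
  With \<open>y = t p\<^sub>j\<close>, the \<open>j\<close>-th category contributes exactly \<open>p\<^sub>j log_excess (t p\<^sub>j)\<close> to the bias.
\<close>

definition log_excess :: "real \<Rightarrow> real" where
  "log_excess y = poisson_mean (\<lambda>k. ln (real k + 1)) y - ln y"

lemma poisson_mean_mono:
  fixes f g :: "nat \<Rightarrow> real"
  assumes "0 < y" "f \<in> O(\<lambda>k. 2 ^ k)" "g \<in> O(\<lambda>k. 2 ^ k)" "\<And>k. f k \<le> g k"
  shows "poisson_mean f y \<le> poisson_mean g y"
  using assms by (intro integral_mono integrable_poisson) auto

lemma
  shows bigo_const: "(\<lambda>k. 1 :: real) \<in> O(\<lambda>k. 2 ^ k)"
    and bigo_ident: "(\<lambda>k. real k) \<in> O(\<lambda>k. 2 ^ k)"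
    and bigo_ln_Suc: "(\<lambda>k. ln (real k + 1)) \<in> O(\<lambda>k. 2 ^ k)"
    and bigo_ln_Suc_Suc: "(\<lambda>k. ln (real k + 2)) \<in> O(\<lambda>k. 2 ^ k)"
    and bigo_xlnx: "(\<lambda>k. real k * ln (real k)) \<in> O(\<lambda>k. 2 ^ k)"
    and bigo_xlnx_Suc: "(\<lambda>k. (real k + 1) * ln (real k + 1)) \<in> O(\<lambda>k. 2 ^ k)"
    and bigo_x_ln_Suc: "(\<lambda>k. real k * ln (real k + 1)) \<in> O(\<lambda>k. 2 ^ k)"
    and bigo_inverse_Suc: "(\<lambda>k. 1 / (real k + 1)) \<in> O(\<lambda>k. 2 ^ k)"
    and bigo_x_inverse: "(\<lambda>k. real k * inverse (real k)) \<in> O(\<lambda>k. 2 ^ k)"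
  by real_asymp+

lemmas bigo_facts =
  bigo_const bigo_ident bigo_ln_Suc bigo_ln_Suc_Suc bigo_xlnx
  bigo_xlnx_Suc bigo_x_ln_Suc bigo_inverse_Suc bigo_x_inverse

lemma bigo_cmult:
  fixes f :: "nat \<Rightarrow> real"
  shows "f \<in> O(g) \<Longrightarrow> (\<lambda>k. c * f k) \<in> O(g)"
  by (cases "c = 0") simp_all

lemma poisson_mean_ident: "0 < y \<Longrightarrow> poisson_mean real y = y"
  using poisson_mean_size_bias[of y "\<lambda>_. 1"] bigo_facts by simp

text \<open>
  By the Stein--Chen identity with \<open>f(k) = 1 / k\<close>; the convention \<open>1 / 0 = 0\<close> makes \<open>k f(k)\<close> the
  indicator of \<open>k \<noteq> 0\<close>.
\<close>

lemma poisson_mean_inverse_Suc: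
  assumes y: "0 < y"
  shows "y * poisson_mean (\<lambda>k. 1 / (real k + 1)) y = 1 - exp (- y)"
proof -
  have "y * poisson_mean (\<lambda>k. 1 / (real k + 1)) y = poisson_mean (\<lambda>k. real k * inverse (real k)) y"
    using poisson_mean_size_bias[of y "\<lambda>k. inverse (real k)"] y bigo_facts
    by (simp add: field_simps)
  also have "(\<lambda>k. real k * inverse (real k)) = (\<lambda>k. 1 - indicator {0} k)"
    by (auto simp: fun_eq_iff indicator_def)
  also have "poisson_mean \<dots> y = 1 - poisson_mean (indicator {0}) y"
    by (subst Bochner_Integration.integral_diff) (auto intro!: integrable_real_indicator simp: measure_pmf.emeasure_eq_measure)
  also have "poisson_mean (indicator {0}) y = exp (- y)"
    using y by (simp add: measure_pmf_single)
  finally show ?thesis .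
qed

lemma ln_upper_tangent: "0 < x \<Longrightarrow> 0 < m \<Longrightarrow> ln x \<le> ln m + (x - m) / m" for x m :: real
  using ln_le_minus_one[of "x / m"] by (simp add: ln_div field_simps)

text \<open>
  Jensen's inequality for the concave logarithm, in the form of the tangent at the mean \<open>y + 1\<close>.
\<close>

lemma poisson_mean_ln_le:
  assumes y: "0 < y"
  shows "poisson_mean (\<lambda>k. ln (real k + 1)) y \<le> ln (y + 1)"
proof -
  have "poisson_mean (\<lambda>k. ln (real k + 1)) y \<le>
      poisson_mean (\<lambda>k. (ln (y + 1) - y / (y + 1)) + real k / (y + 1)) y"
  proof (rule poisson_mean_mono[OF y bigo_ln_Suc])
    show "(\<lambda>k. (ln (y + 1) - y / (y + 1)) + real k / (y + 1)) \<in> O(\<lambda>k. 2 ^ k)"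
      using bigo_cmult[OF bigo_const] bigo_cmult[OF bigo_ident, of "1 / (y + 1)"]
      by (intro sum_in_bigo) auto
    show "ln (real k + 1) \<le> (ln (y + 1) - y / (y + 1)) + real k / (y + 1)" for k
      using ln_upper_tangent[of "real k + 1" "y + 1"] y by (simp add: diff_divide_distrib)
  qed
  also have "\<dots> = ln (y + 1)"
    using integrable_poisson[OF y bigo_ident] y by (simp add: poisson_mean_ident)
  finally show ?thesis .
qed

lemma log_excess_upper:
  assumes "0 < y"
  shows "log_excess y \<le> ln (1 + 1 / y)"
proof -
  have "1 + 1 / y = (y + 1) / y" using assms by (simp add: field_simps)
  then show ?thesis
    using poisson_mean_ln_le[OF assms] assms by (simp add: log_excess_def ln_div)
qed

text \<open>
  From \<open>ln x \<ge> ln y + 1 - y / x\<close> at \<open>x = P + 1\<close>, where the mean of \<open>y / (P + 1)\<close> is known from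
  \<open>poisson_mean_inverse_Suc\<close>. Every category thus contributes positively to the bias, and this is what
  keeps the limiting constant away from \<open>0\<close>.
\<close>

lemma log_excess_lower:
  assumes y: "0 < y"
  shows "exp (- y) \<le> log_excess y"
proof -
  have "poisson_mean (\<lambda>k. (ln y + 1) - y * (1 / (real k + 1))) y \<le> poisson_mean (\<lambda>k. ln (real k + 1)) y"
  proof (rule poisson_mean_mono[OF y _ bigo_ln_Suc])
    show "(\<lambda>k. (ln y + 1) - y * (1 / (real k + 1))) \<in> O(\<lambda>k. 2 ^ k)"
      by (intro sum_in_bigo bigo_cmult bigo_facts bigo_cmult[OF bigo_const, simplified])
    show "(ln y + 1) - y * (1 / (real k + 1)) \<le> ln (real k + 1)" for k
      using ln_upper_tangent[of y "real k + 1"] y by (simp add: field_simps)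
  qed
  also have "poisson_mean (\<lambda>k. (ln y + 1) - y * (1 / (real k + 1))) y = ln y + exp (- y)"
    using integrable_poisson[OF y bigo_inverse_Suc] poisson_mean_inverse_Suc[OF y]
    by (subst Bochner_Integration.integral_diff) (auto simp del: times_divide_eq_right)
  finally show ?thesis by (simp add: log_excess_def)
qed

lemma poisson_mean_xlnx:
  assumes y: "0 < y"
  shows "poisson_mean (\<lambda>k. real k * ln (real k)) y = y * poisson_mean (\<lambda>k. ln (real k + 1)) y"
  using poisson_mean_size_bias[of y "\<lambda>k. ln (real k)"] y bigo_facts by (simp add: add.commute)

lemma psi_eq_increment:
  assumes y: "0 < y"
  shows "psi y = poisson_mean (\<lambda>k. (real k + 1) * ln (real k + 1)) y
    - poisson_mean (\<lambda>k. real k * ln (real k)) y - ln y - 1"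
proof -
  have "poisson_mean (\<lambda>k. (real k + 1 - y) * ln (real k + 1)) y =
      poisson_mean (\<lambda>k. (real k + 1) * ln (real k + 1) - y * ln (real k + 1)) y"
    by (simp add: left_diff_distrib)
  also have "\<dots> = poisson_mean (\<lambda>k. (real k + 1) * ln (real k + 1)) y
    - poisson_mean (\<lambda>k. real k * ln (real k)) y"
    using integrable_poisson[OF y bigo_xlnx_Suc] integrable_poisson[OF y bigo_ln_Suc]
    by (subst Bochner_Integration.integral_diff) (auto simp: poisson_mean_xlnx[OF y])
  finally show ?thesis by (simp add: psi_def)
qed

text \<open>
  The function \<open>psi\<close> of the theorem is the derivative of the contribution \<open>y log_excess y\<close> of a category
  with expected count \<open>y\<close>, on the scale where the bias is multiplied by \<open>t\<close>.
\<close>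

lemma DERIV_bias_psi:
  assumes y: "0 < y"
  shows "((\<lambda>y. y * log_excess y) has_real_derivative psi y) (at y)"
proof -
  have "((\<lambda>y. poisson_mean (\<lambda>k. real k * ln (real k)) y - y * ln y) has_real_derivative psi y) (at y)"
    using y by (auto intro!: derivative_eq_intros DERIV_poisson_mean bigo_facts
                     simp: psi_eq_increment add.commute)
  then show ?thesis
    by (rule DERIV_cong_ev[THEN iffD1, rotated -1])
       (use y in \<open>auto simp: log_excess_def poisson_mean_xlnx algebra_simps eventually_nhds
                       intro!: exI[of _ "{0<..}"]\<close>)
qed

lemma isCont_psi:
  assumes y: "0 < y"
  shows "isCont psi y"
proof -
  have *: "isCont (\<lambda>y. poisson_mean f y) y" if "f \<in> O(\<lambda>k. 2 ^ k)" for f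
    using DERIV_poisson_mean[OF y that] by (rule DERIV_isCont)
  have "isCont (\<lambda>y. poisson_mean (\<lambda>k. (real k + 1) * ln (real k + 1)) y
    - poisson_mean (\<lambda>k. real k * ln (real k)) y - ln y - 1) y"
    using y by (intro continuous_intros * bigo_facts) auto
  then show ?thesis
    by (rule isCont_cong[THEN iffD1, rotated -1])
       (use y in \<open>auto simp: psi_eq_increment eventually_nhds intro!: exI[of _ "{0<..}"]\<close>)
qed

text \<open>
  In this form the two summands that tend to \<open>0\<close> and \<open>1\<close> at infinity are separated, and the
  cancellation against the final \<open>- 1\<close> yields decay of order \<open>1 / y\<close>.
\<close>

lemma psi_eq_log_excess:
  assumes y: "0 < y"
  shows "psi y = log_excess y + y * poisson_mean (\<lambda>k. ln (real k + 2) - ln (real k + 1)) y - 1"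
proof -
  have i: "integrable (measure_pmf (poisson_pmf y)) f" if "f \<in> O(\<lambda>k. 2 ^ k)" for f :: "nat \<Rightarrow> real"
    by (rule integrable_poisson[OF y that])
  have "poisson_mean (\<lambda>k. (real k + 1) * ln (real k + 1)) y =
      poisson_mean (\<lambda>k. real k * ln (real k + 1)) y + poisson_mean (\<lambda>k. ln (real k + 1)) y"
    by (subst Bochner_Integration.integral_add[symmetric]) (auto intro!: i bigo_facts simp: distrib_right)
  moreover have "poisson_mean (\<lambda>k. real k * ln (real k + 1)) y = y * poisson_mean (\<lambda>k. ln (real k + 2)) y"
    using poisson_mean_size_bias[of y "\<lambda>k. ln (real k + 1)"] y bigo_facts by (simp add: add.commute)
  moreover have "poisson_mean (\<lambda>k. ln (real k + 2) - ln (real k + 1)) y =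
      poisson_mean (\<lambda>k. ln (real k + 2)) y - poisson_mean (\<lambda>k. ln (real k + 1)) y"
    by (rule Bochner_Integration.integral_diff) (auto intro!: i bigo_facts)
  ultimately show ?thesis
    by (simp add: psi_eq_increment[OF y] poisson_mean_xlnx[OF y] log_excess_def right_diff_distrib)
qed

lemma psi_upper:
  assumes y: "0 < y"
  shows "psi y \<le> ln (1 + 1 / y)"
proof -
  have "poisson_mean (\<lambda>k. ln (real k + 2) - ln (real k + 1)) y \<le> poisson_mean (\<lambda>k. 1 / (real k + 1)) y"
  proof (rule poisson_mean_mono[OF y _ bigo_inverse_Suc])
    show "(\<lambda>k. ln (real k + 2) - ln (real k + 1)) \<in> O(\<lambda>k. 2 ^ k)"
      by (intro sum_in_bigo bigo_facts)
    show "ln (real k + 2) - ln (real k + 1) \<le> 1 / (real k + 1)" for k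
      using ln_upper_tangent[of "real k + 2" "real k + 1"] by simp
  qed
  then have "y * poisson_mean (\<lambda>k. ln (real k + 2) - ln (real k + 1)) y \<le> 1 - exp (- y)"
    unfolding poisson_mean_inverse_Suc[OF y, symmetric] using y by (intro mult_left_mono) auto
  then show ?thesis
    using psi_eq_log_excess[OF y] log_excess_upper[OF y] exp_gt_zero[of "- y"] by linarith
qed

text \<open>
  The bound \<open>ln ((k + 2) / (k + 1)) \<ge> 1 / (k + 2)\<close> is followed by Jensen's inequality for \<open>1 / x\<close>, again as
  a tangent at the mean \<open>m = y + 2\<close>.
\<close>

lemma psi_lower:
  assumes y: "0 < y"
  shows "- 2 / (y + 2) \<le> psi y"
proof -
  define m where "m = y + 2"
  have m: "m > 0" using y by (simp add: m_def)
  have tangent: "2 / m - x / m\<^sup>2 \<le> 1 / x" if "x > 0" for x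
  proof -
    have "1 / x - (2 / m - x / m\<^sup>2) = (x - m)\<^sup>2 / (x * m\<^sup>2)"
      using that m by (simp add: field_simps power2_eq_square)
    moreover have "(x - m)\<^sup>2 / (x * m\<^sup>2) \<ge> 0" using that by simp
    ultimately show ?thesis by linarith
  qed
  have "poisson_mean (\<lambda>k. (2 / m - 2 / m\<^sup>2) - real k / m\<^sup>2) y \<le>
      poisson_mean (\<lambda>k. ln (real k + 2) - ln (real k + 1)) y"
  proof (rule poisson_mean_mono[OF y])
    show "(\<lambda>k. (2 / m - 2 / m\<^sup>2) - real k / m\<^sup>2) \<in> O(\<lambda>k. 2 ^ k)"
      using bigo_cmult[OF bigo_const] bigo_cmult[OF bigo_ident, of "1 / m\<^sup>2"]
      by (intro sum_in_bigo) auto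
    show "(\<lambda>k. ln (real k + 2) - ln (real k + 1)) \<in> O(\<lambda>k. 2 ^ k)"
      by (intro sum_in_bigo bigo_facts)
    show "(2 / m - 2 / m\<^sup>2) - real k / m\<^sup>2 \<le> ln (real k + 2) - ln (real k + 1)" for k
      using tangent[of "real k + 2"] ln_upper_tangent[of "real k + 1" "real k + 2"]
      by (simp add: add_divide_distrib)
  qed
  moreover have "poisson_mean (\<lambda>k. (2 / m - 2 / m\<^sup>2) - real k / m\<^sup>2) y = 1 / m"
  proof -
    have "poisson_mean (\<lambda>k. (2 / m - 2 / m\<^sup>2) - real k / m\<^sup>2) y = (2 / m - 2 / m\<^sup>2) - y / m\<^sup>2"
      using integrable_poisson[OF y bigo_ident] by (simp add: poisson_mean_ident[OF y])
    also have "\<dots> = 2 / m - m / m\<^sup>2"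
      by (simp add: m_def add_divide_distrib)
    also have "\<dots> = 1 / m"
      using m by (simp add: field_simps power2_eq_square)
    finally show ?thesis .
  qed
  ultimately have "y * (1 / m) \<le> y * poisson_mean (\<lambda>k. ln (real k + 2) - ln (real k + 1)) y"
    using y by (intro mult_left_mono) auto
  moreover have "y * (1 / m) - 1 = - 2 / (y + 2)"
    using y by (simp add: m_def field_simps)
  moreover have "log_excess y \<ge> 0"
    using log_excess_lower[OF y] exp_gt_zero[of "- y"] by linarith
  ultimately show ?thesis
    using psi_eq_log_excess[OF y] by linarith
qed

lemma abs_psi_le:
  assumes y: "0 < y"
  shows "\<bar>psi y\<bar> \<le> 2 / y"
proof -
  have "ln (1 + 1 / y) \<le> 1 / y" using y by (intro ln_add_one_self_le_self) auto
  also have "\<dots> \<le> 2 / y" using y by (simp add: divide_right_mono)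
  finally have "psi y \<le> 2 / y" using psi_upper[OF y] by linarith
  moreover have "2 / (y + 2) \<le> 2 / y" using y by (intro divide_left_mono) auto
  then have "- (2 / y) \<le> psi y" using psi_lower[OF y] by simp
  ultimately show ?thesis by simp
qed

lemma ln_one_plus_inverse_le_powr:
  fixes y c :: real
  assumes "0 < y" "y \<le> 1" "0 < c"
  shows "ln (1 + 1 / y) \<le> 2 powr c / c * y powr (- c)"
proof -
  have "ln (1 + 1 / y) \<le> ln (2 / y :: real)"
    using assms by (subst ln_le_cancel_iff) (auto simp: field_simps add_pos_pos)
  also have "\<dots> \<le> (2 / y) powr c / c"
    using assms by (intro ln_powr_bound) (auto simp: field_simps)
  finally show ?thesis
    using assms by (simp add: powr_divide powr_minus field_simps)
qed

text \<open>
  At the origin \<open>psi\<close> has only a logarithmic singularity, here absorbed into an arbitrarily small power.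
\<close>

lemma abs_psi_le_powr:
  assumes "0 < y" "y \<le> 1" "0 < c"
  shows "\<bar>psi y\<bar> \<le> (1 + 2 powr c / c) * y powr (- c)"
proof -
  have 1: "1 \<le> y powr (- c)"
    using assms by (simp add: powr_minus one_le_inverse_iff powr_le1)
  have "2 / (y + 2) \<le> 1" using assms by simp
  then have "- 1 \<le> psi y" using psi_lower[OF assms(1)] by simp
  moreover have "psi y \<le> 2 powr c / c * y powr (- c)"
    using psi_upper[OF assms(1)] ln_one_plus_inverse_le_powr[OF assms] by linarith
  moreover have "2 powr c / c * y powr (- c) \<ge> 0" using assms by simp
  ultimately show ?thesis using 1 by (simp add: algebra_simps)
qed

section \<open>Monotone regularly varying functions\<close>

text \<open>
  Iterating the doubling inequality gives the power bound along \<open>s = 2\<^sup>k\<close>; monotonicity fills the gaps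
  between consecutive powers of two at the cost of the factor \<open>2\<^sup>b\<close>.
\<close>

lemma doubling_imp_powr_upper:
  fixes N :: "real \<Rightarrow> real"
  assumes mono: "mono N" and nonneg: "\<And>u. 0 \<le> N u" and U: "0 < U" and b: "0 \<le> b"
    and double: "\<And>u. U \<le> u \<Longrightarrow> N (2 * u) \<le> 2 powr b * N u"
    and s: "1 \<le> s" and u: "U \<le> u"
  shows "N (s * u) \<le> 2 powr b * s powr b * N u"
proof -
  have iter: "N (2 ^ k * u) \<le> (2 ^ k) powr b * N u" for k :: nat
  proof (induction k)
    case (Suc k)
    have "1 * u \<le> 2 ^ k * u" using u U by (intro mult_right_mono) auto
    then have "N (2 * (2 ^ k * u)) \<le> 2 powr b * N (2 ^ k * u)"
      using u by (intro double) simp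
    also have "\<dots> \<le> 2 powr b * ((2 ^ k) powr b * N u)"
      using Suc by (intro mult_left_mono) auto
    finally show ?case by (simp add: powr_mult mult_ac)
  qed simp
  define k where "k = nat \<lfloor>log 2 s\<rfloor>"
  have k: "2 ^ k \<le> s" "s \<le> 2 ^ Suc k"
  proof -
    have "real k \<le> log 2 s" "log 2 s \<le> real (Suc k)"
      using s unfolding k_def by (simp_all, linarith)
    then show "2 ^ k \<le> s" "s \<le> 2 ^ Suc k"
      using s by (simp_all add: le_log_iff log_le_iff powr_realpow del: of_nat_Suc power_Suc)
  qed
  have "N (s * u) \<le> N (2 ^ Suc k * u)"
    using k u U by (intro monoD[OF mono] mult_right_mono) auto
  also have "\<dots> \<le> (2 ^ Suc k) powr b * N u" by (rule iter)
  also have "\<dots> \<le> (2 * s) powr b * N u"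
    using k b by (intro mult_right_mono powr_mono2 nonneg) auto
  finally show ?thesis using s by (simp add: powr_mult)
qed

lemma doubling_imp_powr_lower:
  fixes N :: "real \<Rightarrow> real"
  assumes mono: "mono N" and nonneg: "\<And>u. 0 \<le> N u" and U: "0 < U" and b: "0 \<le> b"
    and double: "\<And>u. U \<le> u \<Longrightarrow> 2 powr b * N u \<le> N (2 * u)"
    and s: "1 \<le> s" and u: "U \<le> u"
  shows "s powr b * N u \<le> 2 powr b * N (s * u)"
proof -
  have iter: "(2 ^ k) powr b * N u \<le> N (2 ^ k * u)" for k :: nat
  proof (induction k)
    case (Suc k)
    have "1 * u \<le> 2 ^ k * u" using u U by (intro mult_right_mono) auto
    then have "2 powr b * N (2 ^ k * u) \<le> N (2 * (2 ^ k * u))"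
      using u by (intro double) simp
    moreover have "2 powr b * ((2 ^ k) powr b * N u) \<le> 2 powr b * N (2 ^ k * u)"
      using Suc by (intro mult_left_mono) auto
    ultimately have "2 powr b * ((2 ^ k) powr b * N u) \<le> N (2 * (2 ^ k * u))" by linarith
    then show ?case by (simp add: powr_mult mult_ac)
  qed simp
  define k where "k = nat \<lfloor>log 2 s\<rfloor>"
  have k: "2 ^ k \<le> s" "s \<le> 2 * 2 ^ k"
  proof -
    have "real k \<le> log 2 s" "log 2 s \<le> real (Suc k)"
      using s unfolding k_def by (simp_all, linarith)
    then show "2 ^ k \<le> s" "s \<le> 2 * 2 ^ k"
      using s by (simp_all add: le_log_iff log_le_iff powr_realpow powr_add)
  qed
  have "s powr b * N u \<le> (2 * 2 ^ k) powr b * N u"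
    using k s b by (intro mult_right_mono powr_mono2 nonneg) auto
  also have "\<dots> = 2 powr b * ((2 ^ k) powr b * N u)" by (simp add: powr_mult)
  also have "\<dots> \<le> 2 powr b * N (2 ^ k * u)" by (intro mult_left_mono iter) auto
  also have "\<dots> \<le> 2 powr b * N (s * u)"
    using k u U by (intro mult_left_mono monoD[OF mono] mult_right_mono) auto
  finally show ?thesis .
qed

text \<open>
  Potter's bounds. In general they need the uniform convergence theorem for slowly varying functions;
  for a monotone function the two doubling lemmas suffice, so that only the limit along the single
  ratio \<open>2\<close> is used. Since \<open>N\<close> vanishes below \<open>1\<close>, the bound for \<open>y \<ge> 1\<close> extends
  to those \<open>y\<close> for which \<open>t / y\<close> falls below the threshold \<open>T\<close>.
\<close>

lemma potter_bounds:
  fixes N :: "real \<Rightarrow> real"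
  assumes mono: "mono N" and zero: "\<And>u. u < 1 \<Longrightarrow> N u = 0"
    and pos: "eventually (\<lambda>u. 0 < N u) at_top"
    and lim: "((\<lambda>u. N (2 * u) / N u) \<longlongrightarrow> 2 powr a) at_top"
    and d: "0 < d" "d < a" and b: "a < b"
  obtains T C where "0 < T" "0 < C" "\<And>t. T \<le> t \<Longrightarrow> 0 < N t"
    "\<And>t y. T \<le> t \<Longrightarrow> 0 < y \<Longrightarrow> y \<le> 1 \<Longrightarrow> N (t / y) \<le> C * y powr (- b) * N t"
    "\<And>t y. T \<le> t \<Longrightarrow> 1 \<le> y \<Longrightarrow> N (t / y) \<le> C * y powr (- d) * N t"
proof -
  have nonneg: "0 \<le> N u" for u
    using zero[of "min u 0"] monoD[OF mono, of "min u 0" u] by simp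
  have "eventually (\<lambda>u. N (2 * u) / N u < 2 powr b) at_top"
    by (rule order_tendstoD(2)[OF lim]) (use b in simp)
  moreover have "eventually (\<lambda>u. 2 powr d < N (2 * u) / N u) at_top"
    by (rule order_tendstoD(1)[OF lim]) (use d in simp)
  ultimately have "eventually (\<lambda>u. 0 < N u \<and> N (2 * u) / N u < 2 powr b \<and> 2 powr d < N (2 * u) / N u) at_top"
    using pos by eventually_elim auto
  then obtain T0 where T0: "0 < N u \<and> N (2 * u) / N u < 2 powr b \<and> 2 powr d < N (2 * u) / N u" if "T0 \<le> u" for u
    by (auto simp: eventually_at_top_linorder)
  define T where "T = max T0 1"
  have T: "T \<ge> 1" by (simp add: T_def)
  have Npos: "0 < N u" and up: "N (2 * u) \<le> 2 powr b * N u" and lo: "2 powr d * N u \<le> N (2 * u)"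
    if "T \<le> u" for u
    using T0[of u] that by (auto simp: T_def field_simps)
  have upper: "N (s * u) \<le> 2 powr b * s powr b * N u" if "1 \<le> s" "T \<le> u" for s u
    by (rule doubling_imp_powr_upper[OF mono nonneg, of T]) (use that T up d b in auto)
  have lower: "s powr d * N u \<le> 2 powr d * N (s * u)" if "1 \<le> s" "T \<le> u" for s u
    by (rule doubling_imp_powr_lower[OF mono nonneg, of T]) (use that T lo d b in auto)
  define C where "C = max (2 powr b) (2 powr d * T powr d)"
  show thesis
  proof (rule that[of T C])
    show "0 < T" using T by simp
    show "0 < C" by (simp add: C_def less_max_iff_disj)
    show "0 < N t" if "T \<le> t" for t by (rule Npos[OF that])
    show "N (t / y) \<le> C * y powr (- b) * N t" if "T \<le> t" "0 < y" "y \<le> 1" for t y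
    proof -
      have "N (t / y) \<le> 2 powr b * (1 / y) powr b * N t"
        using upper[of "1 / y" t] that by simp
      also have "\<dots> \<le> C * (1 / y) powr b * N t"
        by (intro mult_right_mono nonneg) (auto simp: C_def)
      finally show ?thesis using that by (simp add: powr_minus powr_divide field_simps)
    qed
    show "N (t / y) \<le> C * y powr (- d) * N t" if t: "T \<le> t" and y: "1 \<le> y" for t y
    proof -
      have *: "y powr d * N (t / y) \<le> C * N t"
      proof (cases "T \<le> t / y")
        case True
        have "y powr d * N (t / y) \<le> 2 powr d * N t"
          using lower[OF y True] y by simp
        also have "\<dots> \<le> 2 powr d * T powr d * N t"
          using T d nonneg by (intro mult_right_mono) (auto simp: ge_one_powr_ge_zero)
        also have "\<dots> \<le> C * N t"
          by (intro mult_right_mono nonneg) (auto simp: C_def)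
        finally show ?thesis .
      next
        case False
        \<comment> \<open>between \<open>1\<close> and \<open>T\<close>, where doubling is not available, \<open>N (t / y) \<le> N T\<close> and \<open>y \<le> t\<close>\<close>
        show ?thesis
        proof (cases "t / y < 1")
          case True
          have "0 \<le> C" by (simp add: C_def le_max_iff_disj)
          then show ?thesis using True zero[OF True] nonneg[of t] by simp
        next
          case False': False
          have ty: "y \<le> t" using False' y by (simp add: field_simps)
          have "y powr d * N (t / y) \<le> t powr d * N T"
            using False ty y d nonneg by (intro mult_mono powr_mono2 monoD[OF mono]) auto
          also have "\<dots> = T powr d * ((t / T) powr d * N T)"
            using T t by (simp add: powr_divide)
          also have "\<dots> \<le> T powr d * (2 powr d * N t)"
            using lower[of "t / T" T] T t by (intro mult_left_mono) (auto simp: field_simps)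
          also have "\<dots> \<le> C * N t"
            unfolding mult.assoc[symmetric]
            by (intro mult_right_mono nonneg) (simp add: C_def mult.commute)
          finally show ?thesis .
        qed
      qed
      then show ?thesis using y by (simp add: powr_minus field_simps)
    qed
  qed
qed

lemma set_integrable_powr_near_0:
  fixes a :: real
  assumes "- 1 < a"
  shows "set_integrable lborel {0<..1} (\<lambda>x. x powr a)"
proof -
  have "(\<lambda>x. x powr a) integrable_on {0<..1}"
    using integrable_on_powr_from_0'[OF assms, of 1] by simp
  then have "set_integrable lebesgue {0<..1} (\<lambda>x. x powr a)"
    by (intro nonnegative_absolutely_integrable_1) auto
  then show ?thesis
    unfolding set_integrable_def by (subst (asm) integrable_completion) auto
qed

lemma set_integrable_powr_near_infinity:
  fixes a :: real
  assumes "a < - 1"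
  shows "set_integrable lborel {1<..} (\<lambda>x. x powr a)"
proof -
  have "(\<lambda>x. x powr a) integrable_on {1..}"
    using has_integral_powr_to_inf[OF assms, of 1] by (auto simp: integrable_on_def)
  then have "set_integrable lebesgue {1..} (\<lambda>x. x powr a)"
    by (intro nonnegative_absolutely_integrable_1) auto
  then have "set_integrable lborel {1..} (\<lambda>x. x powr a)"
    unfolding set_integrable_def by (subst (asm) integrable_completion) auto
  then show ?thesis by (rule set_integrable_subset) auto
qed

text \<open>
  An Abelian theorem: if \<open>N\<close> varies regularly with index \<open>a\<close>, then \<open>N (t / y) / N t\<close> tends to \<open>y\<^sup>-\<^sup>a\<close>, and the
  limit passes under the integral. Potter's bounds with exponents \<open>d < a < b\<close> provide the integrable
  majorant: \<open>b\<close> is chosen with \<open>b + c < 1\<close> for integrability at \<open>0\<close>, and any \<open>d > 0\<close> makes up for the decay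
  \<open>1 / y\<close> of \<open>f\<close>, which alone is not integrable at infinity.
\<close>

lemma regularly_varying_integral_limit:
  fixes N f :: "real \<Rightarrow> real"
  assumes mono: "mono N" and zero: "\<And>u. u < 1 \<Longrightarrow> N u = 0"
    and pos: "eventually (\<lambda>u. 0 < N u) at_top"
    and lim: "\<And>s. 0 < s \<Longrightarrow> ((\<lambda>u. N (s * u) / N u) \<longlongrightarrow> s powr a) at_top"
    and a: "0 < a" and c: "0 \<le> c" "a + c < 1"
    and f_meas: "set_borel_measurable lborel {0<..} f"
    and near_0: "\<And>y. 0 < y \<Longrightarrow> y \<le> 1 \<Longrightarrow> \<bar>f y\<bar> \<le> A * y powr (- c)"
    and near_inf: "\<And>y. 1 \<le> y \<Longrightarrow> \<bar>f y\<bar> \<le> B / y"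
  shows "set_integrable lborel {0<..} (\<lambda>y. y powr (- a) * f y)"
    and "eventually (\<lambda>t. set_integrable lborel {0<..} (\<lambda>y. N (t / y) * f y)) at_top"
    and "((\<lambda>t. (LBINT y:{0<..}. N (t / y) * f y) / N t) \<longlongrightarrow>
          (LBINT y:{0<..}. y powr (- a) * f y)) at_top"
proof -
  define b where "b = (1 + a - c) / 2"
  define d where "d = a / 2"
  have bd: "0 < d" "d < a" "a < b" "b + c < 1" using a c by (auto simp: b_def d_def field_simps)
  obtain T C where T: "0 < T" and C: "0 < C" and Npos: "\<And>t. T \<le> t \<Longrightarrow> 0 < N t"
    and P0: "\<And>t y. T \<le> t \<Longrightarrow> 0 < y \<Longrightarrow> y \<le> 1 \<Longrightarrow> N (t / y) \<le> C * y powr (- b) * N t"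
    and P1: "\<And>t y. T \<le> t \<Longrightarrow> 1 \<le> y \<Longrightarrow> N (t / y) \<le> C * y powr (- d) * N t"
    using potter_bounds[OF mono zero pos lim[of 2] bd(1,2,3)] by auto
  have nonneg: "0 \<le> N u" for u
    using zero[of "min u 0"] monoD[OF mono, of "min u 0" u] by simp
  define K where "K = max C 1"
  define w where "w y = K * (A * (indicator {0<..1} y * y powr (- (b + c)))
    + B * (indicator {1<..} y * y powr (- (1 + d))))" for y :: real
  have w_int: "integrable lborel w"
    unfolding w_def
    using set_integrable_powr_near_0[of "- (b + c)"] set_integrable_powr_near_infinity[of "- (1 + d)"] bd
    by (auto simp: set_integrable_def)
  \<comment> \<open>both the kernels \<open>N (t / y) / N t\<close> and their limit obey the same two power bounds\<close>
  have bound: "norm (indicator {0<..} y * (r * f y)) \<le> w y"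
    if r: "0 \<le> r" "0 < y \<Longrightarrow> y \<le> 1 \<Longrightarrow> r \<le> K * y powr (- b)" "1 \<le> y \<Longrightarrow> r \<le> K * y powr (- d)"
    for r y
  proof -
    consider "y \<le> 0" | "0 < y" "y \<le> 1" | "1 < y" by linarith
    then show ?thesis
    proof cases
      case 2
      have "\<bar>r * f y\<bar> = r * \<bar>f y\<bar>" using r by (simp add: abs_mult)
      also have "\<dots> \<le> (K * y powr (- b)) * (A * y powr (- c))"
        using 2 r near_0[of y] by (intro mult_mono) (auto simp: K_def)
      also have "\<dots> = K * A * y powr (- (b + c))" by (simp add: powr_add[symmetric])
      finally show ?thesis using 2 by (simp add: w_def)
    next
      case 3
      have "\<bar>r * f y\<bar> = r * \<bar>f y\<bar>" using r by (simp add: abs_mult)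
      also have "\<dots> \<le> (K * y powr (- d)) * (B / y)"
        using 3 r near_inf[of y] by (intro mult_mono) (auto simp: K_def)
      also have "\<dots> = K * B * y powr (- (1 + d))"
        using 3 by (simp add: powr_diff powr_minus field_simps)
      finally show ?thesis using 3 by (simp add: w_def)
    qed (simp add: w_def)
  qed
  have f_meas': "(\<lambda>y. indicator {0<..} y * f y) \<in> borel_measurable borel"
    using f_meas by (simp add: set_borel_measurable_def)
  have N_meas: "N \<in> borel_measurable borel" by (rule borel_measurable_mono[OF mono])
  have meas: "(\<lambda>y. indicator {0<..} y * (g y * f y)) \<in> borel_measurable lborel"
    if [measurable]: "g \<in> borel_measurable borel" for g :: "real \<Rightarrow> real"
  proof -
    have "(\<lambda>y. g y * (indicator {0<..} y * f y)) \<in> borel_measurable borel"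
      using f_meas' by measurable
    then show ?thesis by (simp add: mult_ac)
  qed
  have meas_N: "(\<lambda>y. N (t / y)) \<in> borel_measurable borel" for t
    using N_meas by measurable
  have bound_pow: "norm (indicator {0<..} y * (y powr (- a) * f y)) \<le> w y" for y
  proof (rule bound)
    show "y powr (- a) \<le> K * y powr (- b)" if "0 < y" "y \<le> 1"
    proof -
      have "1 * y powr (- a) \<le> K * y powr (- b)"
        using that bd by (intro mult_mono powr_mono') (auto simp: K_def)
      then show ?thesis by simp
    qed
    show "y powr (- a) \<le> K * y powr (- d)" if "1 \<le> y"
    proof -
      have "1 * y powr (- a) \<le> K * y powr (- d)"
        using that bd by (intro mult_mono powr_mono) (auto simp: K_def)
      then show ?thesis by simp
    qed
  qed simp
  have bound_N: "norm (indicator {0<..} y * (N (t / y) / N t * f y)) \<le> w y" if t: "T \<le> t" for t y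
  proof (rule bound)
    show "0 \<le> N (t / y) / N t" using nonneg by simp
    show "N (t / y) / N t \<le> K * y powr (- b)" if "0 < y" "y \<le> 1"
    proof -
      have "N (t / y) / N t \<le> C * y powr (- b)"
        using P0[OF t that] Npos[OF t] by (simp add: field_simps)
      also have "\<dots> \<le> K * y powr (- b)" by (intro mult_right_mono) (auto simp: K_def)
      finally show ?thesis .
    qed
    show "N (t / y) / N t \<le> K * y powr (- d)" if "1 \<le> y"
    proof -
      have "N (t / y) / N t \<le> C * y powr (- d)"
        using P1[OF t that] Npos[OF t] by (simp add: field_simps)
      also have "\<dots> \<le> K * y powr (- d)" by (intro mult_right_mono) (auto simp: K_def)
      finally show ?thesis .
    qed
  qed
  show "set_integrable lborel {0<..} (\<lambda>y. y powr (- a) * f y)"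
    unfolding set_integrable_def real_scaleR_def
    by (rule Bochner_Integration.integrable_bound[OF w_int meas[OF _] AE_I2])
       (measurable, rule order_trans[OF bound_pow], simp)
  have int_N: "set_integrable lborel {0<..} (\<lambda>y. N (t / y) * f y)" if t: "T \<le> t" for t
  proof -
    have "set_integrable lborel {0<..} (\<lambda>y. N (t / y) / N t * f y)"
      unfolding set_integrable_def real_scaleR_def
      by (rule Bochner_Integration.integrable_bound[OF w_int meas[OF borel_measurable_divide[OF meas_N]] AE_I2])
         (simp, rule order_trans[OF bound_N[OF t]], simp)
    then have "set_integrable lborel {0<..} (\<lambda>y. N t * (N (t / y) / N t * f y))"
      by (rule set_integrable_mult_right)
    then show ?thesis using Npos[OF t] by simp
  qed
  then show "eventually (\<lambda>t. set_integrable lborel {0<..} (\<lambda>y. N (t / y) * f y)) at_top"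
    by (auto simp: eventually_at_top_linorder)
  have "((\<lambda>t. LBINT y. indicator {0<..} y * (N (t / y) / N t * f y)) \<longlongrightarrow>
      (LBINT y. indicator {0<..} y * (y powr (- a) * f y))) at_top"
  proof (rule integral_dominated_convergence_at_top[OF meas meas w_int])
    show "eventually (\<lambda>t. AE y in lborel. norm (indicator {0<..} y * (N (t / y) / N t * f y)) \<le> w y) at_top"
      using bound_N by (auto simp: eventually_at_top_linorder)
    show "AE y in lborel. ((\<lambda>t. indicator {0<..} y * (N (t / y) / N t * f y)) \<longlongrightarrow>
        indicator {0<..} y * (y powr (- a) * f y)) at_top"
    proof (rule AE_I2)
      fix y :: real
      show "((\<lambda>t. indicator {0<..} y * (N (t / y) / N t * f y)) \<longlongrightarrow>
        indicator {0<..} y * (y powr (- a) * f y)) at_top"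
      proof (cases "0 < y")
        case True
        have "((\<lambda>t. N (t / y) / N t) \<longlongrightarrow> (1 / y) powr a) at_top"
          using lim[of "1 / y"] True by simp
        also have "(1 / y) powr a = y powr (- a)"
          using True by (simp add: powr_divide powr_minus field_simps)
        finally show ?thesis by (intro tendsto_intros)
      qed simp
    qed
  qed (use meas_N in auto)
  moreover have "(LBINT y. indicator {0<..} y * (N (t / y) / N t * f y)) =
      (LBINT y:{0<..}. N (t / y) * f y) / N t" for t
    unfolding set_lebesgue_integral_def
    by (subst Bochner_Integration.integral_divide_zero[symmetric]) (simp add: mult_ac)
  ultimately show "((\<lambda>t. (LBINT y:{0<..}. N (t / y) * f y) / N t) \<longlongrightarrow>
          (LBINT y:{0<..}. y powr (- a) * f y)) at_top"
    by (simp add: set_lebesgue_integral_def)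
qed

lemma tendsto_log_excess_0: "((\<lambda>y. y * log_excess y) \<longlongrightarrow> 0) (at_right 0)"
proof (rule tendsto_sandwich)
  show "eventually (\<lambda>y. 0 \<le> y * log_excess y) (at_right 0)"
    unfolding eventually_at_right_field
    by (rule exI[of _ 1]) (auto intro!: mult_nonneg_nonneg order_trans[OF _ log_excess_lower])
  show "eventually (\<lambda>y. y * log_excess y \<le> y * ln (1 + 1 / y)) (at_right 0)"
    unfolding eventually_at_right_field
    by (rule exI[of _ 1]) (auto intro!: mult_left_mono log_excess_upper)
  show "((\<lambda>y::real. y * ln (1 + 1 / y)) \<longlongrightarrow> 0) (at_right 0)" by real_asymp
qed simp

lemma psi_measurable:
  assumes "A \<in> sets borel" "A \<subseteq> {0<..}"
  shows "set_borel_measurable lborel A psi"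
  using borel_measurable_continuous_on_indicator[OF assms(1), of psi] assms(2) isCont_psi
  by (auto simp: set_borel_measurable_def intro!: continuous_at_imp_continuous_on)

lemma psi_integrable_near_0: "set_integrable lborel {0<..x} psi"
proof -
  \<comment> \<open>any exponent in \<open>(0, 1)\<close> would serve in place of \<open>1 / 2\<close>\<close>
  have 1: "set_integrable lborel {0<..1} psi"
  proof (rule set_integrable_bound)
    show "set_integrable lborel {0<..1} (\<lambda>y::real. (1 + 2 powr (1/2) / (1/2)) * y powr (- (1/2)))"
      by (intro set_integrable_mult_right set_integrable_powr_near_0) simp
    show "set_borel_measurable lborel {0<..1} psi" by (rule psi_measurable) auto
    show "AE y in lborel. y \<in> {0<..1} \<longrightarrow> norm (psi y) \<le> norm ((1 + 2 powr (1/2) / (1/2)) * y powr (- (1/2)))"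
      using abs_psi_le_powr[of _ "1/2"] by (intro AE_I2) (auto intro!: order_trans[OF _ abs_ge_self])
  qed
  have 2: "set_integrable lborel {1..max 1 x} psi"
    by (rule borel_integrable_atLeastAtMost') (auto intro!: continuous_at_imp_continuous_on isCont_psi)
  show ?thesis
    by (rule set_integrable_subset[OF set_integrable_Un[OF 1 2]]) auto
qed

text \<open>
  The fundamental theorem of calculus on the half-open interval; the boundary term at \<open>0\<close> vanishes by
  \<open>tendsto_log_excess_0\<close>.
\<close>

lemma integral_psi:
  assumes x: "0 < x"
  shows "(LBINT y:{0<..x}. psi y) = x * log_excess x"
proof -
  have "(LBINT y=ereal 0..ereal x. psi y) = x * log_excess x - 0"
  proof (rule interval_integral_FTC_integrable[where F = "\<lambda>y. y * log_excess y"])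
    show "((\<lambda>y. y * log_excess y) has_vector_derivative psi y) (at y)" if "ereal 0 < ereal y" for y
      using DERIV_bias_psi[of y] that by (simp add: has_real_derivative_iff_has_vector_derivative)
    show "set_integrable lborel (einterval (ereal 0) (ereal x)) psi"
      by (rule set_integrable_subset[OF psi_integrable_near_0[of x]]) (auto simp: einterval_def)
    show "(((\<lambda>y. y * log_excess y) \<circ> real_of_ereal) \<longlongrightarrow> 0) (at_right (ereal 0))"
      using tendsto_log_excess_0 by (simp only: ereal_tendsto_simps)
    have "isCont (\<lambda>y. y * log_excess y) x" by (rule DERIV_isCont[OF DERIV_bias_psi[OF x]])
    then show "(((\<lambda>y. y * log_excess y) \<circ> real_of_ereal) \<longlongrightarrow> x * log_excess x) (at_left (ereal x))"
      by (simp only: ereal_tendsto_simps) (auto simp: isCont_def intro: tendsto_mono[OF at_le])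
  qed (use x in \<open>auto intro: isCont_psi\<close>)
  then show ?thesis using x by (simp add: interval_integral_Ioc)
qed

section \<open>Counting categories\<close>

text \<open>
  The counting function of a distribution with positive weights in the reciprocal variable, so that it is increasing and regularly varying at
  infinity. For \<open>u \<le> 0\<close> all categories are counted and the cardinality of this infinite set is \<open>0\<close> by
  convention, which conveniently agrees with the value for \<open>0 < u < 1\<close>.
\<close>

definition category_count :: "(nat \<Rightarrow> real) \<Rightarrow> real \<Rightarrow> real" where
  "category_count p u = real (counting_fun p (inverse u))"

lemma finite_level_set:
  fixes p :: "nat \<Rightarrow> real"
  assumes "summable p" "0 < x"
  shows "finite {j. x \<le> p j}"
proof -
  have "eventually (\<lambda>j. p j < x) sequentially"
    using summable_LIMSEQ_zero[OF assms(1)] assms(2) by (rule order_tendstoD)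
  then obtain n where n: "\<And>j. n \<le> j \<Longrightarrow> p j < x" by (auto simp: eventually_sequentially)
  have "{j. x \<le> p j} \<subseteq> {..<n}" using n by (force simp: not_le[symmetric])
  then show ?thesis by (rule finite_subset) simp
qed

lemma category_count_nonpos:
  assumes "\<And>j. 0 < p j" "u \<le> 0"
  shows "category_count p u = 0"
proof -
  have "inverse u \<le> 0" using assms(2) by simp
  then have "{j. inverse u \<le> p j} = UNIV" using assms(1) less_imp_le order_trans by blast
  then show ?thesis by (simp add: category_count_def counting_fun_def)
qed

lemma mono_category_count:
  assumes "\<And>j. 0 < p j" "summable p"
  shows "mono (category_count p)"
proof (rule monoI)
  fix u v :: real assume uv: "u \<le> v"
  show "category_count p u \<le> category_count p v"
  proof (cases "u \<le> 0")
    case True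
    then show ?thesis using category_count_nonpos[OF assms(1) True] by (simp add: category_count_def)
  next
    case False
    then have "inverse v \<le> inverse u" using uv by (intro le_imp_inverse_le) auto
    then have "{j. inverse u \<le> p j} \<subseteq> {j. inverse v \<le> p j}" by (blast intro: order_trans)
    then have "card {j. inverse u \<le> p j} \<le> card {j. inverse v \<le> p j}"
      using False uv by (intro card_mono finite_level_set assms) auto
    then show ?thesis by (simp add: category_count_def counting_fun_def)
  qed
qed

text \<open>
  The layer-cake formula \<open>\<Sum>\<^sub>j F(t p\<^sub>j) = \<integral> N(t / y) f(y) dy\<close> for a primitive \<open>F\<close> of \<open>f\<close> with \<open>F(0) = 0\<close>: interchange
  the sum over \<open>j\<close> and the integral of \<open>f\<close> over \<open>(0, t p\<^sub>j]\<close>.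
\<close>

lemma sums_level_integral:
  fixes p :: "nat \<Rightarrow> real" and f F :: "real \<Rightarrow> real"
  assumes p: "summable p" and t: "0 < t"
    and f: "\<And>x. set_integrable lborel {0<..x} f"
    and F: "\<And>j. (LBINT y:{0<..t * p j}. f y) = F (t * p j)"
    and int: "set_integrable lborel {0<..} (\<lambda>y. category_count p (t / y) * f y)"
  shows "(\<lambda>j. F (t * p j)) sums (LBINT y:{0<..}. category_count p (t / y) * f y)"
proof -
  define h where "h j y = indicator {0<..t * p j} y * f y" for j y
  have h_int: "integrable lborel (h j)" for j
    using f[of "t * p j"] by (simp add: h_def[abs_def] set_integrable_def)
  \<comment> \<open>the point \<open>y\<close> lies in exactly \<open>category_count p (t / y)\<close> of the intervals\<close>
  have level: "finite {j. y \<le> t * p j} \<and> category_count p (t / y) = real (card {j. y \<le> t * p j})"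
    if "0 < y" for y
  proof -
    have "{j. y \<le> t * p j} = {j. inverse (t / y) \<le> p j}" using t that by (auto simp: field_simps)
    then show ?thesis using finite_level_set[OF p, of "inverse (t / y)"] t that
      by (simp add: category_count_def counting_fun_def)
  qed
  \<comment> \<open>\<open>\<phi>\<close> will be the identity, to evaluate the sum, and the norm, to justify the interchange\<close>
  have sums_h: "(\<lambda>j. \<phi> (h j y)) sums (indicator {0<..} y * category_count p (t / y) * \<phi> (f y))"
    if \<phi>: "\<phi> 0 = 0" for \<phi> :: "real \<Rightarrow> real" and y
  proof (cases "0 < y")
    case True
    have "(\<lambda>j. \<phi> (h j y)) sums (\<Sum>j\<in>{j. y \<le> t * p j}. \<phi> (h j y))"
      by (rule sums_finite) (use level[OF True] \<phi> True in \<open>auto simp: h_def\<close>)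
    also have "(\<Sum>j\<in>{j. y \<le> t * p j}. \<phi> (h j y)) = (\<Sum>j\<in>{j. y \<le> t * p j}. \<phi> (f y))"
      using True by (intro sum.cong) (auto simp: h_def)
    finally show ?thesis using level[OF True] True by simp
  qed (simp add: h_def \<phi>)
  have "summable (\<lambda>j. \<integral>y. norm (h j y) \<partial>lborel)"
  proof (rule summableI_nonneg_bounded)
    fix n
    have "(\<Sum>j<n. \<integral>y. norm (h j y) \<partial>lborel) = (\<integral>y. (\<Sum>j<n. norm (h j y)) \<partial>lborel)"
      by (rule Bochner_Integration.integral_sum[symmetric]) (use h_int in auto)
    also have "\<dots> \<le> (\<integral>y. norm (indicator {0<..} y *\<^sub>R (category_count p (t / y) * f y)) \<partial>lborel)"
    proof (rule integral_mono)
      show "integrable lborel (\<lambda>y. norm (indicator {0<..} y *\<^sub>R (category_count p (t / y) * f y)))"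
        using int unfolding set_integrable_def by (rule integrable_norm)
      show "(\<Sum>j<n. norm (h j y)) \<le> norm (indicator {0<..} y *\<^sub>R (category_count p (t / y) * f y))" for y
        using sum_le_suminf[of "\<lambda>j. norm (h j y)" "{..<n}"] sums_h[of norm y]
        by (auto simp: sums_iff abs_mult category_count_def)
    qed (use h_int in auto)
    finally show "(\<Sum>j<n. \<integral>y. norm (h j y) \<partial>lborel) \<le>
      (\<integral>y. norm (indicator {0<..} y *\<^sub>R (category_count p (t / y) * f y)) \<partial>lborel)" .
  qed simp
  then have "(\<lambda>j. \<integral>y. h j y \<partial>lborel) sums (\<integral>y. (\<Sum>j. h j y) \<partial>lborel)"
    using sums_h[of norm] by (intro sums_integral h_int AE_I2) (auto simp: sums_iff)
  moreover have "(\<Sum>j. h j y) = indicator {0<..} y * (category_count p (t / y) * f y)" for y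
    using sums_h[of "\<lambda>x. x" y] by (simp add: sums_iff mult_ac)
  ultimately show ?thesis
    using F by (simp add: set_lebesgue_integral_def h_def)
qed

section \<open>Expectation of the estimator\<close>

text \<open>
  Expanding \<open>ln (k / t)\<close> reduces everything to the means of \<open>k ln k\<close> and \<open>k\<close>. At \<open>y = t p\<^sub>j\<close>
  the bound on the absolute mean is at most \<open>p\<^sub>j\<close> times a quantity independent of \<open>j\<close>, which allows
  summation over all categories.
\<close>

lemma poisson_entropy_term:
  assumes y: "0 < y" and t: "0 < t"
  defines "h \<equiv> \<lambda>k. real k / t * ln (real k / t)"
  shows "integrable (measure_pmf (poisson_pmf y)) h"
    and "poisson_mean h y = y / t * (poisson_mean (\<lambda>k. ln (real k + 1)) y - ln t)"
    and "poisson_mean (\<lambda>k. \<bar>h k\<bar>) y \<le> y / t * (y + \<bar>ln t\<bar>)"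
proof -
  have h: "h k = 1 / t * (real k * ln (real k)) - ln t / t * real k" for k
    using t by (cases "k = 0") (auto simp: h_def ln_div field_simps)
  note i = integrable_poisson[OF y bigo_xlnx] integrable_poisson[OF y bigo_ident]
  note i' = integrable_mult_right[OF i(1), of "1 / t"] integrable_mult_right[OF i(2)]
  note m = poisson_mean_xlnx[OF y] poisson_mean_ident[OF y]
  show h_int: "integrable (measure_pmf (poisson_pmf y)) h"
    unfolding h using i' by (intro Bochner_Integration.integrable_diff)
  have "poisson_mean h y = 1 / t * (y * poisson_mean (\<lambda>k. ln (real k + 1)) y) - ln t / t * y"
    unfolding h by (subst Bochner_Integration.integral_diff[OF i']) (simp only: integral_mult_right_zero m)
  then show "poisson_mean h y = y / t * (poisson_mean (\<lambda>k. ln (real k + 1)) y - ln t)"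
    by (simp add: right_diff_distrib mult.commute)
  have "\<bar>h k\<bar> \<le> 1 / t * (real k * ln (real k)) + \<bar>ln t\<bar> / t * real k" for k
  proof -
    have "0 \<le> real k * ln (real k)" by (cases "k = 0") auto
    then have "\<bar>1 / t * (real k * ln (real k))\<bar> = 1 / t * (real k * ln (real k))" using t by simp
    moreover have "\<bar>ln t / t * real k\<bar> = \<bar>ln t\<bar> / t * real k" using t by (simp add: abs_mult)
    ultimately show ?thesis
      unfolding h
      using abs_triangle_ineq4[of "1 / t * (real k * ln (real k))" "ln t / t * real k"]
      by (simp only:)
  qed
  then have "poisson_mean (\<lambda>k. \<bar>h k\<bar>) y \<le>
      poisson_mean (\<lambda>k. 1 / t * (real k * ln (real k)) + \<bar>ln t\<bar> / t * real k) y"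
    using i' h_int by (intro integral_mono) auto
  also have "\<dots> = 1 / t * (y * poisson_mean (\<lambda>k. ln (real k + 1)) y) + \<bar>ln t\<bar> / t * y"
    by (subst Bochner_Integration.integral_add[OF i']) (simp only: integral_mult_right_zero m)
  also have "\<dots> = y / t * (poisson_mean (\<lambda>k. ln (real k + 1)) y + \<bar>ln t\<bar>)"
    by (simp add: distrib_left mult.commute)
  also have "\<dots> \<le> y / t * (y + \<bar>ln t\<bar>)"
    using poisson_mean_ln_le[OF y] ln_add_one_self_le_self[of y] y t
    by (intro mult_left_mono) (auto simp: add.commute)
  finally show "poisson_mean (\<lambda>k. \<bar>h k\<bar>) y \<le> y / t * (y + \<bar>ln t\<bar>)" .
qed

lemma AE_summable_norm:
  fixes f :: "nat \<Rightarrow> 'a \<Rightarrow> real"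
  assumes int: "\<And>j. integrable M (f j)" and sum: "summable (\<lambda>j. \<integral>x. norm (f j x) \<partial>M)"
  shows "AE x in M. summable (\<lambda>j. norm (f j x))"
proof -
  have [measurable]: "f j \<in> borel_measurable M" for j using int by auto
  have "(\<integral>\<^sup>+x. (\<Sum>j. ennreal (norm (f j x))) \<partial>M) = (\<Sum>j. \<integral>\<^sup>+x. ennreal (norm (f j x)) \<partial>M)"
    by (rule nn_integral_suminf) measurable
  also have "\<dots> = (\<Sum>j. ennreal (\<integral>x. norm (f j x) \<partial>M))"
    using int by (intro suminf_cong nn_integral_eq_integral) auto
  also have "\<dots> \<noteq> \<infinity>"
    using sum by (simp add: ennreal_suminf_neq_top)
  finally have "AE x in M. (\<Sum>j. ennreal (norm (f j x))) \<noteq> \<infinity>"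
    by (intro nn_integral_PInf_AE) auto
  then show ?thesis
    by eventually_elim (auto intro: summable_suminf_not_top)
qed

lemma expectation_plug_in:
  fixes p :: "nat \<Rightarrow> real" and X :: "nat \<Rightarrow> 'w \<Rightarrow> nat"
  assumes p_pos: "\<And>j. 0 < p j" and p_le: "\<And>j. p j \<le> 1" and p_sum: "summable p" and t: "0 < t"
    and X: "\<And>j. X j \<in> measurable M (count_space UNIV)"
    and X_distr: "\<And>j. distr M (count_space UNIV) (X j) = measure_pmf (poisson_pmf (t * p j))"
  shows "integrable M (\<lambda>\<omega>. poissonized_plug_in t (\<lambda>j. X j \<omega>))"
    and "(\<lambda>j. p j * (ln t - poisson_mean (\<lambda>k. ln (real k + 1)) (t * p j))) sums
      (\<integral>\<omega>. poissonized_plug_in t (\<lambda>j. X j \<omega>) \<partial>M)"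
proof -
  define h where "h = (\<lambda>k. real k / t * ln (real k / t))"
  have y: "0 < t * p j" for j using t p_pos by simp
  have distr: "(\<integral>\<omega>. g (X j \<omega>) \<partial>M) = poisson_mean g (t * p j)" for g :: "nat \<Rightarrow> real" and j
    by (subst X_distr[symmetric], subst integral_distr) (use X in auto)
  have h_int: "integrable M (\<lambda>\<omega>. h (X j \<omega>))" for j
    using poisson_entropy_term(1)[OF y[of j] t] X
    unfolding X_distr[symmetric] h_def by (subst (asm) integrable_distr_eq) auto
  have sum: "summable (\<lambda>j. \<integral>\<omega>. norm (h (X j \<omega>)) \<partial>M)"
  proof (rule summable_comparison_test)
    show "summable (\<lambda>j. p j * (t + \<bar>ln t\<bar>))" by (rule summable_mult2[OF p_sum])
    have "norm (\<integral>\<omega>. norm (h (X j \<omega>)) \<partial>M) \<le> p j * (t + \<bar>ln t\<bar>)" for j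
    proof -
      have "norm (\<integral>\<omega>. norm (h (X j \<omega>)) \<partial>M) = poisson_mean (\<lambda>k. \<bar>h k\<bar>) (t * p j)"
        using distr[of "\<lambda>k. \<bar>h k\<bar>" j] by (simp add: integral_nonneg_AE)
      also have "\<dots> \<le> (t * p j) / t * (t * p j + \<bar>ln t\<bar>)"
        using poisson_entropy_term(3)[OF y t] by (simp add: h_def)
      also have "\<dots> \<le> p j * (t + \<bar>ln t\<bar>)"
        using t p_pos[of j] p_le[of j] by (simp add: mult_left_le)
      finally show ?thesis .
    qed
    then show "\<exists>N. \<forall>n\<ge>N. norm (\<integral>\<omega>. norm (h (X n \<omega>)) \<partial>M) \<le> p n * (t + \<bar>ln t\<bar>)" by blast
  qed
  note AE = AE_summable_norm[OF h_int sum]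
  have plug_in: "poissonized_plug_in t (\<lambda>j. X j \<omega>) = - (\<Sum>j. h (X j \<omega>))" for \<omega>
    by (simp add: poissonized_plug_in_def h_def)
  show "integrable M (\<lambda>\<omega>. poissonized_plug_in t (\<lambda>j. X j \<omega>))"
    unfolding plug_in by (intro Bochner_Integration.integrable_minus integrable_suminf h_int AE sum)
  have "(\<lambda>j. - (\<integral>\<omega>. h (X j \<omega>) \<partial>M)) sums - (\<integral>\<omega>. (\<Sum>j. h (X j \<omega>)) \<partial>M)"
    by (intro sums_minus sums_integral h_int AE sum)
  also have "- (\<integral>\<omega>. (\<Sum>j. h (X j \<omega>)) \<partial>M) = (\<integral>\<omega>. poissonized_plug_in t (\<lambda>j. X j \<omega>) \<partial>M)"
    unfolding plug_in by simp
  also have "(\<lambda>j. - (\<integral>\<omega>. h (X j \<omega>) \<partial>M)) =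
      (\<lambda>j. p j * (ln t - poisson_mean (\<lambda>k. ln (real k + 1)) (t * p j)))"
  proof
    fix j
    have "(\<integral>\<omega>. h (X j \<omega>) \<partial>M) = p j * (poisson_mean (\<lambda>k. ln (real k + 1)) (t * p j) - ln t)"
      unfolding distr unfolding h_def poisson_entropy_term(2)[OF y t] using t by simp
    then show "- (\<integral>\<omega>. h (X j \<omega>) \<partial>M) = p j * (ln t - poisson_mean (\<lambda>k. ln (real k + 1)) (t * p j))"
      by (simp add: right_diff_distrib)
  qed
  finally show "(\<lambda>j. p j * (ln t - poisson_mean (\<lambda>k. ln (real k + 1)) (t * p j))) sums
      (\<integral>\<omega>. poissonized_plug_in t (\<lambda>j. X j \<omega>) \<partial>M)" .
qed

section \<open>Asymptotics of the bias\<close>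

text \<open>
  The entropy series differs from that of the bias by \<open>p\<^sub>j E[ln (P + 1)] - p\<^sub>j ln t\<close> only, and these terms
  are dominated by multiples of \<open>p\<^sub>j\<close>. Hence convergence of the bias series at a single \<open>t\<close> implies
  convergence of the entropy series.
\<close>

lemma summable_entropy:
  fixes p :: "nat \<Rightarrow> real"
  assumes p_pos: "\<And>j. 0 < p j" and p_le: "\<And>j. p j \<le> 1" and p_sum: "summable p" and t: "0 < t"
    and g: "summable (\<lambda>j. t * p j * log_excess (t * p j))"
  shows "summable (\<lambda>j. p j * ln (p j))"
proof -
  let ?m = "\<lambda>j. poisson_mean (\<lambda>k. ln (real k + 1)) (t * p j)"
  have y: "0 < t * p j" for j using t p_pos by simp
  have "summable (\<lambda>j. p j * ?m j)"
  proof (rule summable_comparison_test)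
    show "summable (\<lambda>j. p j * t)" by (rule summable_mult2[OF p_sum])
    have "norm (p j * ?m j) \<le> p j * t" for j
    proof -
      have "?m j \<le> t * p j"
        using poisson_mean_ln_le[OF y[of j]] ln_add_one_self_le_self[of "t * p j"] y[of j]
        by (simp add: add.commute)
      also have "\<dots> \<le> t" using t p_le[of j] by simp
      finally have "?m j \<le> t" .
      moreover have "0 \<le> ?m j" by (rule Bochner_Integration.integral_nonneg) simp
      ultimately show ?thesis using p_pos[of j] by (simp add: abs_mult)
    qed
    then show "\<exists>N. \<forall>n\<ge>N. norm (p n * ?m n) \<le> p n * t" by blast
  qed
  then have "summable (\<lambda>j. p j * ?m j - p j * ln t - 1 / t * (t * p j * log_excess (t * p j)))"
    by (intro summable_diff summable_mult summable_mult2 g p_sum)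
  also have "(\<lambda>j. p j * ?m j - p j * ln t - 1 / t * (t * p j * log_excess (t * p j))) = (\<lambda>j. p j * ln (p j))"
    using t p_pos by (auto simp: fun_eq_iff log_excess_def ln_mult algebra_simps)
  finally show ?thesis .
qed

text \<open>
  Retain only the categories with expected count in \<open>[1, 2)\<close>, each of which contributes at least
  \<open>e\<^sup>-\<^sup>2\<close>. By regular variation, asymptotically a fixed proportion of the categories counted by
  \<open>category_count p t\<close> is of this kind.
\<close>

lemma bias_lower:
  fixes p :: "nat \<Rightarrow> real"
  assumes p_pos: "\<And>j. 0 < p j" and p_sum: "summable p" and t: "0 < t"
    and g: "(\<lambda>j. t * p j * log_excess (t * p j)) sums S"
  shows "exp (- 2) * (category_count p t - category_count p (t / 2)) \<le> S"
proof -
  let ?A = "{j. inverse t \<le> p j}" and ?B = "{j. inverse (t / 2) \<le> p j}"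
  have fin: "finite ?A" "finite ?B" using t by (auto intro!: finite_level_set p_sum)
  have "inverse t \<le> inverse (t / 2)" using t by (intro le_imp_inverse_le) auto
  then have sub: "?B \<subseteq> ?A" by auto
  have "category_count p t - category_count p (t / 2) = real (card (?A - ?B))"
    using card_mono[OF fin(1) sub]
    by (simp only: category_count_def counting_fun_def card_Diff_subset[OF fin(2) sub] of_nat_diff)
  then have "exp (- 2) * (category_count p t - category_count p (t / 2)) = (\<Sum>j\<in>?A - ?B. exp (- 2))"
    by simp
  also have "\<dots> \<le> (\<Sum>j\<in>?A - ?B. t * p j * log_excess (t * p j))"
  proof (rule sum_mono)
    fix j assume "j \<in> ?A - ?B"
    then have y: "1 \<le> t * p j" "t * p j < 2" using t by (auto simp: field_simps)
    have "1 * exp (- 2) \<le> t * p j * log_excess (t * p j)"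
      using y by (intro mult_mono order_trans[OF _ log_excess_lower]) auto
    then show "exp (- 2) \<le> t * p j * log_excess (t * p j)" by simp
  qed
  also have "\<dots> \<le> (\<Sum>j. t * p j * log_excess (t * p j))"
    using g fin t p_pos
    by (intro sum_le_suminf)
       (auto simp: sums_iff intro!: mult_nonneg_nonneg order_trans[OF _ log_excess_lower] less_imp_le[OF p_pos])
  also have "\<dots> = S" using g by (simp add: sums_iff)
  finally show ?thesis .
qed

theorem theorem4p1:
  fixes p :: "nat \<Rightarrow> real" and \<alpha> :: real and L :: "real \<Rightarrow> real"
    and M :: "'w measure" and X :: "real \<Rightarrow> nat \<Rightarrow> 'w \<Rightarrow> nat"
  assumes p_pos: "\<And>j. p j > 0"
    and p_sums: "p sums 1"
    and \<alpha>: "0 < \<alpha>" "\<alpha> < 1"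
    and L_pos: "\<forall>\<^sub>F u in at_top. L u > 0"
    and L_sv: "slowly_varying L"
    and nu: "\<And>x. 0 < x \<Longrightarrow> x \<le> 1 \<Longrightarrow> real (counting_fun p x) = x powr (-\<alpha>) * L (inverse x)"
    and M: "prob_space M"
    and X_indep: "\<And>t. t > 0 \<Longrightarrow> prob_space.indep_vars M (\<lambda>_. count_space UNIV) (X t) UNIV"
    and X_distr: "\<And>t j. t > 0 \<Longrightarrow>
      distr M (count_space UNIV) (X t j) = measure_pmf (poisson_pmf (t * p j))"
  shows "summable (\<lambda>j. p j * ln (p j)) \<and>
    (\<forall>t>0. integrable M (\<lambda>\<omega>. poissonized_plug_in t (\<lambda>j. X t j \<omega>))) \<and>
    set_integrable lborel {0<..} (\<lambda>y. y powr (-\<alpha>) * psi y) \<and>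
    (\<lambda>t. shannon_entropy p - prob_space.expectation M (\<lambda>\<omega>. poissonized_plug_in t (\<lambda>j. X t j \<omega>)))
      \<sim>[at_top] (\<lambda>t. t powr (\<alpha> - 1) * L t * C_const \<alpha>)"
proof -
  have p_sum: "summable p" using p_sums by (rule sums_summable)
  have p_le: "p j \<le> 1" for j
    using sum_le_suminf[OF p_sum, of "{j}"] p_pos p_sums by (auto simp: sums_iff less_imp_le)
  define N where "N = category_count p"
  have N_mono: "mono N" unfolding N_def by (rule mono_category_count[OF p_pos p_sum])
  have N_zero: "N u = 0" if "u < 1" for u
  proof (cases "u \<le> 0")
    case False
    then have "1 < inverse u" using that by (simp add: one_less_inverse_iff)
    then have "{j. inverse u \<le> p j} = {}" using p_le by (auto simp: not_le intro: le_less_trans)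
    then show ?thesis by (simp add: N_def category_count_def counting_fun_def)
  qed (use category_count_nonpos[OF p_pos] in \<open>simp add: N_def\<close>)
  have N_eq: "N u = u powr \<alpha> * L u" if "1 \<le> u" for u
    using nu[of "inverse u"] that
    by (simp add: N_def category_count_def inverse_le_1_iff powr_minus inverse_powr)
  have ge_1: "eventually (\<lambda>u. 1 \<le> (u::real)) at_top" by (rule eventually_ge_at_top)
  have N_pos: "eventually (\<lambda>u. 0 < N u) at_top"
    using L_pos ge_1 by eventually_elim (simp add: N_eq)
  have N_lim: "((\<lambda>u. N (s * u) / N u) \<longlongrightarrow> s powr \<alpha>) at_top" if s: "0 < s" for s
  proof -
    have "((\<lambda>u. s powr \<alpha> * (L (s * u) / L u)) \<longlongrightarrow> s powr \<alpha> * 1) at_top"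
      using L_sv s by (intro tendsto_intros) (simp add: slowly_varying_def)
    moreover have "eventually (\<lambda>u. s powr \<alpha> * (L (s * u) / L u) = N (s * u) / N u) at_top"
      using ge_1 eventually_ge_at_top[of "1 / s"]
      by eventually_elim (use s in \<open>simp add: N_eq powr_mult field_simps\<close>)
    ultimately show ?thesis by (simp add: tendsto_cong)
  qed
  define I where "I t = (LBINT y:{0<..}. N (t / y) * psi y)" for t
  define c where "c = (1 - \<alpha>) / 2"
  have c: "0 < c" "\<alpha> + c < 1" using \<alpha> by (auto simp: c_def field_simps)
  note limit = regularly_varying_integral_limit[OF N_mono N_zero N_pos N_lim \<alpha>(1) less_imp_le[OF c(1)] c(2)
      psi_measurable[of "{0<..}"] abs_psi_le_powr[OF _ _ c(1)], of 2]
  have psi_int: "set_integrable lborel {0<..} (\<lambda>y. y powr (- \<alpha>) * psi y)"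
    by (rule limit(1)) (auto intro: abs_psi_le)
  have N_int: "eventually (\<lambda>t. set_integrable lborel {0<..} (\<lambda>y. N (t / y) * psi y)) at_top"
    by (rule limit(2)) (auto intro: abs_psi_le)
  have I_lim: "((\<lambda>t. I t / N t) \<longlongrightarrow> C_const \<alpha>) at_top"
    unfolding I_def C_const_def by (rule limit(3)) (auto intro: abs_psi_le)
  have sums_I: "eventually (\<lambda>t. (\<lambda>j. t * p j * log_excess (t * p j)) sums I t) at_top"
    using N_int eventually_gt_at_top[of 0]
  proof eventually_elim
    case (elim t)
    show ?case
      unfolding I_def N_def
    proof (rule sums_level_integral[OF p_sum elim(2) psi_integrable_near_0])
      show "(LBINT y:{0<..t * p j}. psi y) = t * p j * log_excess (t * p j)" for j
        using elim p_pos by (intro integral_psi) simp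
    qed (use elim in \<open>simp add: N_def\<close>)
  qed
  have entropy: "summable (\<lambda>j. p j * ln (p j))"
  proof -
    have "eventually (\<lambda>t. 0 < t \<and> summable (\<lambda>j. t * p j * log_excess (t * p j))) at_top"
      using sums_I eventually_gt_at_top[of 0] by eventually_elim (auto simp: sums_iff)
    then obtain t where "0 < t" "summable (\<lambda>j. t * p j * log_excess (t * p j))"
      using eventually_happens[of _ "at_top :: real filter"] by auto
    then show ?thesis by (rule summable_entropy[OF p_pos p_le p_sum])
  qed
  \<comment> \<open>\<open>psi\<close> changes sign, so positivity is read off from the limit and not from the integral\<close>
  have C_pos: "0 < C_const \<alpha>"
  proof -
    have half: "((\<lambda>t. N (t / 2) / N t) \<longlongrightarrow> (1 / 2) powr \<alpha>) at_top"
      using N_lim[of "1 / 2"] by simp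
    have "exp (- 2) * (1 - (1 / 2) powr \<alpha>) \<le> C_const \<alpha>"
    proof (rule tendsto_le[OF _ I_lim])
      show "((\<lambda>t. exp (- 2) * (1 - N (t / 2) / N t)) \<longlongrightarrow> exp (- 2) * (1 - (1 / 2) powr \<alpha>)) at_top"
        by (intro tendsto_intros half)
      show "eventually (\<lambda>t. exp (- 2) * (1 - N (t / 2) / N t) \<le> I t / N t) at_top"
        using sums_I N_pos eventually_gt_at_top[of 0]
      proof eventually_elim
        case (elim t)
        have "exp (- 2) * (1 - N (t / 2) / N t) = exp (- 2) * (N t - N (t / 2)) / N t"
          using elim(2) by (simp add: field_simps)
        also have "\<dots> \<le> I t / N t"
          using bias_lower[OF p_pos p_sum elim(3,1)] elim(2)
          by (intro divide_right_mono) (auto simp: N_def)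
        finally show ?case .
      qed
    qed simp
    moreover have "(1 / 2) powr \<alpha> < (1 :: real)"
      using powr_less_mono2[of \<alpha> "1 / 2" 1] \<alpha> by simp
    ultimately show ?thesis
      by (smt (verit) exp_gt_zero mult_pos_pos)
  qed
  have X_meas: "X t j \<in> measurable M (count_space UNIV)" if "0 < t" for t j
    using X_indep[OF that] by (simp add: prob_space.indep_vars_def[OF M])
  note plug_in = expectation_plug_in[OF p_pos p_le p_sum _ X_meas X_distr]
  let ?bias = "\<lambda>t. shannon_entropy p - (\<integral>\<omega>. poissonized_plug_in t (\<lambda>j. X t j \<omega>) \<partial>M)"
  have bias: "eventually (\<lambda>t. ?bias t = I t / t) at_top"
    using sums_I eventually_gt_at_top[of 0]
  proof eventually_elim
    case (elim t)
    have "(\<lambda>j. - (p j * ln (p j)) - p j * (ln t - poisson_mean (\<lambda>k. ln (real k + 1)) (t * p j))) sums ?bias t"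
      unfolding shannon_entropy_def
      by (intro sums_diff sums_minus summable_sums entropy plug_in(2) elim)
    also have "(\<lambda>j. - (p j * ln (p j)) - p j * (ln t - poisson_mean (\<lambda>k. ln (real k + 1)) (t * p j))) =
        (\<lambda>j. t * p j * log_excess (t * p j) / t)"
    proof
      fix j
      have "ln (t * p j) = ln t + ln (p j)" using elim(2) p_pos by (intro ln_mult_pos)
      moreover have "t * p j * log_excess (t * p j) / t = p j * log_excess (t * p j)"
        using elim(2) by simp
      ultimately show "- (p j * ln (p j)) - p j * (ln t - poisson_mean (\<lambda>k. ln (real k + 1)) (t * p j)) =
          t * p j * log_excess (t * p j) / t"
        by (simp add: log_excess_def right_diff_distrib distrib_left)
    qed
    finally show ?case
      using sums_divide[OF elim(1), of t] by (rule sums_unique2)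
  qed
  have "?bias \<sim>[at_top] (\<lambda>t. t powr (\<alpha> - 1) * L t * C_const \<alpha>)"
  proof (rule asymp_equivI')
    have "((\<lambda>t. I t / N t / C_const \<alpha>) \<longlongrightarrow> C_const \<alpha> / C_const \<alpha>) at_top"
      using C_pos by (intro tendsto_intros I_lim) auto
    then have "((\<lambda>t. I t / N t / C_const \<alpha>) \<longlongrightarrow> 1) at_top" using C_pos by simp
    moreover have "eventually (\<lambda>t. I t / N t / C_const \<alpha> = ?bias t / (t powr (\<alpha> - 1) * L t * C_const \<alpha>)) at_top"
      using bias ge_1
    proof eventually_elim
      case (elim t)
      have "N t = t * (t powr (\<alpha> - 1) * L t)"
        using elim by (simp add: N_eq powr_diff)
      then show ?case unfolding elim(1) by simp
    qed
    ultimately show "((\<lambda>t. ?bias t / (t powr (\<alpha> - 1) * L t * C_const \<alpha>)) \<longlongrightarrow> 1) at_top"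
      by (simp add: tendsto_cong)
  qed
  then show ?thesis using entropy plug_in(1) psi_int by auto
qed

end
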